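(* For any integer $N\ge 2$, the number $I_{N}$ of consecutive irreducible polynomial sequences of length $N$ over $\mathbb{F}_q$ satisfies $$I_N < 3^{-N/7+1} q^{N+1}.$$
   Context: Let $p$ be an odd prime, $q=p^s$ with $s\ge 1$ an integer, and $\mathbb{F}_q$ the finite field with $q$ elements. A consecutive irreducible polynomial sequence of length $N$ over $\mathbb{F}_q$ is a sequence $f_1,\ldots,f_N$ with $f_n=u_nX^n+\cdots+u_1X+u_0\in\mathbb{F}_q[X]$, where $u_0,u_1,\ldots,u_N$ are non-zero elements of $\mathbb{F}_q$, such that every $f_n$ ($1\le n\le N$) is irreducible over $\mathbb{F}_q$. $I_N$ denotes the number of such sequences (equivalently, of such tuples $(u_0,\ldots,u_N)$). *)

theory Defs
  imports Complex_Main "HOL-Computational_Algebra.Polynomial_Factorial" "HOL-Library.Cardinality"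
begin

text \<open>The list \<open>fs\<close> holds \<open>f\<^sub>1, \<dots>, f\<^sub>N\<close>, so that \<open>f\<^sub>n\<close> is \<open>fs ! (n - 1)\<close>.
  Only the values \<open>u 0, \<dots>, u N\<close> of the coefficient function matter.\<close>

definition consecutive_irreducible_seq :: "nat \<Rightarrow> 'a::field poly list \<Rightarrow> bool" where
  "consecutive_irreducible_seq N fs \<longleftrightarrow>
     length fs = N \<and>
     (\<exists>u :: nat \<Rightarrow> 'a.
        (\<forall>i\<le>N. u i \<noteq> 0) \<and>
        (\<forall>n\<in>{1..N}. fs ! (n - 1) = (\<Sum>i\<le>n. monom (u i) i) \<and> irreducible (fs ! (n - 1))))"

definition num_consecutive_irreducible_seqs :: "'a::field itself \<Rightarrow> nat \<Rightarrow> nat" where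
  "num_consecutive_irreducible_seqs _ N =
     card {fs :: 'a poly list. consecutive_irreducible_seq N fs}"

end

theory Submission
  imports Defs
begin

text \<open>For \<open>n \<ge> 2\<close> irreducibility of \<open>f\<^sub>n\<close> is only used through the absence of roots, which forces
  \<open>u\<^sub>n\<close> to avoid the values \<open>- f\<^sub>n\<^sub>-\<^sub>1(a) / a\<^sup>n\<close> for \<open>a \<noteq> 0\<close>. This function of \<open>a\<close> may have a small
  image, but not often: two points \<open>a \<noteq> b\<close> collide for exactly one choice of \<open>u\<^sub>n\<^sub>-\<^sub>1\<close>. Counting
  collisions over all \<open>u\<^sub>n\<^sub>-\<^sub>1\<close> shows that at most half of the \<open>(q - 1)\<^sup>2\<close> pairs \<open>(u\<^sub>n\<^sub>-\<^sub>1, u\<^sub>n)\<close> survive.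
  So two steps gain a factor \<open>2\<close>, and \<open>2\<^sup>1\<^sup>/\<^sup>2 > 3\<^sup>1\<^sup>/\<^sup>7\<close>.\<close>

section \<open>Collisions and extensions without roots\<close>

text \<open>A fibre with k >= 1 elements has k(k-1) ordered colliding pairs, and 2k <= 2 + k(k-1)
  because (k-1)(k-2) >= 0. In the induction, a point joining an occupied fibre creates at least two
  such pairs, one for each order.\<close>

lemma card_le_card_image_plus_collisions:
  assumes "finite S"
  shows "2 * card S \<le> 2 * card (g ` S) + card {(a, b). a \<in> S \<and> b \<in> S \<and> a \<noteq> b \<and> g a = g b}"
  using assms
proof (induction S)
  case empty
  then show ?case by simp
next
  case (insert x S)
  let ?C = "\<lambda>S. {(a, b). a \<in> S \<and> b \<in> S \<and> a \<noteq> b \<and> g a = g b}"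
  have fin: "finite (?C T)" if "finite T" for T
    by (rule finite_subset[of _ "T \<times> T"]) (use that in auto)
  show ?case
  proof (cases "g x \<in> g ` S")
    case True
    then obtain y where y: "y \<in> S" "g y = g x" by force
    have "x \<noteq> y" using y insert.hyps by auto
    then have "card (?C S) + 2 = card (?C S \<union> {(x, y), (y, x)})"
      using insert.hyps fin by (subst card_Un_disjoint) auto
    also have "\<dots> \<le> card (?C (insert x S))"
      using y \<open>x \<noteq> y\<close> insert.hyps by (intro card_mono fin) auto
    finally show ?thesis
      using insert True by (simp add: insert_absorb)
  next
    case False
    have "card (?C S) \<le> card (?C (insert x S))"
      using insert.hyps by (intro card_mono fin) auto
    then show ?thesis
      using insert False by simp
  qed
qed

text \<open>\<open>F\<close> stands for evaluation of the polynomial built so far, and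
  \<open>u\<close>, \<open>v\<close> for the coefficients in degrees \<open>m\<close> and
  \<open>Suc m\<close>. With \<open>F\<close> arbitrary, the count is uniform in that
  polynomial.\<close>

definition root_free_extensions :: "('a::field \<Rightarrow> 'a) \<Rightarrow> nat \<Rightarrow> ('a \<times> 'a) set" where
  "root_free_extensions F m =
     {(u, v). v \<noteq> 0 \<and> (\<forall>a. a \<noteq> 0 \<longrightarrow> F a + u * a ^ m \<noteq> 0)
        \<and> (\<forall>a. a \<noteq> 0 \<longrightarrow> F a + u * a ^ m + v * a ^ Suc m \<noteq> 0)}"

lemma card_root_free_extensions:
  fixes F :: "'a::{field,finite} \<Rightarrow> 'a"
  shows "2 * card (root_free_extensions F m) \<le> (CARD('a) - 1) ^ 2"
proof -
  define S :: "'a set" where "S = UNIV - {0}"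
  define g where "g u a = - (F a + u * a ^ m) / a ^ Suc m" for u a
  define V where "V u = {v. (u, v) \<in> root_free_extensions F m}" for u
  define C where "C u = {(a, b). a \<in> S \<and> b \<in> S \<and> a \<noteq> b \<and> g u a = g u b}" for u
  have card_S: "card S = CARD('a) - 1" by (simp add: S_def card_Diff_singleton)
  have V_le: "2 * card (V u) \<le> card (C u)" for u
  proof (cases "V u = {}")
    case False
    then have nz: "F a + u * a ^ m \<noteq> 0" if "a \<noteq> 0" for a
      using that by (auto simp: V_def root_free_extensions_def)
    have "v \<notin> g u ` S" if "v \<in> V u" for v
    proof
      assume "v \<in> g u ` S"
      then obtain a where a: "a \<noteq> 0" "v = g u a" by (auto simp: S_def)
      then have "F a + u * a ^ m + v * a ^ Suc m = 0" by (simp add: g_def)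
      with a that show False by (auto simp: V_def root_free_extensions_def)
    qed
    moreover have "V u \<subseteq> S" by (auto simp: V_def S_def root_free_extensions_def)
    moreover have "g u a \<noteq> 0" if "a \<noteq> 0" for a
      unfolding g_def divide_eq_0_iff neg_equal_0_iff_equal using nz that by simp
    then have "g u ` S \<subseteq> S" by (auto simp: S_def)
    ultimately have "card (V u \<union> g u ` S) \<le> card S" "V u \<inter> g u ` S = {}"
      by (auto intro!: card_mono)
    then have "card (V u) + card (g u ` S) \<le> card S"
      by (simp add: card_Un_disjoint)
    then show ?thesis
      using card_le_card_image_plus_collisions[of S "g u"] by (simp add: C_def)
  qed simp
  have unique: "u = u'" if "(a, b) \<in> C u" "(a, b) \<in> C u'" for a b u u'
  proof -
    have nz: "a \<noteq> 0" "b \<noteq> 0" "a \<noteq> b" using that by (auto simp: C_def S_def)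
    \<comment> \<open>The parameter enters only through \<open>w / a\<close>, so subtracting the
      collision equations for \<open>u\<close> and \<open>u'\<close> eliminates
      \<open>F\<close>.\<close>
    have eq: "g w a = - F a / a ^ Suc m - w / a" if "a \<noteq> 0" for w a
      using that by (simp add: g_def field_simps)
    have "g u a - g u' a = g u b - g u' b" using that by (simp add: C_def)
    then have "u' / a - u / a = u' / b - u / b"
      unfolding eq[OF nz(1)] eq[OF nz(2)] by simp
    then have "(u' - u) / a = (u' - u) / b"
      by (simp only: diff_divide_distrib)
    then show ?thesis using nz by (auto simp: field_simps)
  qed
  have "root_free_extensions F m = (SIGMA u:UNIV. V u)" by (auto simp: V_def)
  then have "2 * card (root_free_extensions F m) = (\<Sum>u\<in>UNIV. 2 * card (V u))"
    by (simp add: sum_distrib_left)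
  also have "\<dots> \<le> (\<Sum>u\<in>UNIV. card (C u))"
    by (intro sum_mono V_le)
  \<comment> \<open>By \<open>unique\<close> the sets \<open>C u\<close> are disjoint, so all
    collisions together fit into \<open>S \<times> S\<close>.\<close>
  also have "\<dots> = card (\<Union>u. C u)"
    using unique by (intro card_UN_disjoint[symmetric]) auto
  also have "\<dots> \<le> card (S \<times> S)"
    by (intro card_mono) (auto simp: C_def)
  finally show ?thesis by (simp add: card_S power2_eq_square)
qed

section \<open>Removing the last polynomial of a sequence\<close>

lemma coeff_sum_monom: "coeff (\<Sum>i\<le>n. monom (u i) i) k = (if k \<le> n then u k else 0)"
  by (simp add: coeff_sum)

lemma irreducible_imp_no_root:
  fixes f :: "'a::field poly"
  assumes "irreducible f" "degree f \<ge> 2"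
  shows "poly f a \<noteq> 0"
proof
  assume "poly f a = 0"
  then obtain h where h: "f = [:-a, 1:] * h" by (auto simp: poly_eq_0_iff_dvd)
  have "\<not> is_unit [:-a, 1:]" by (simp add: is_unit_iff_degree)
  with irreducibleD[OF assms(1) h] have "is_unit h" by blast
  moreover from this have "h \<noteq> 0" by auto
  ultimately have "degree f = 1"
    by (simp add: h degree_mult_eq is_unit_iff_degree del: mult_pCons_left)
  with assms(2) show False by simp
qed

text \<open>The same coefficient function witnesses the prefix, so sequences can be counted by the
  choices for one more coefficient. For \<open>N \<ge> 1\<close> the prefix is non-empty and the
  removed polynomial is not linear.\<close>

lemma consecutive_irreducible_seq_Suc:
  fixes fs :: "'a::field poly list"
  assumes "consecutive_irreducible_seq (Suc N) fs" "N \<ge> 1"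
  obtains gs u where "consecutive_irreducible_seq N gs" "u \<noteq> 0"
    "fs = gs @ [last gs + monom u (Suc N)]"
    "\<And>a. poly (last gs) a + u * a ^ Suc N \<noteq> 0"
proof -
  obtain u where len: "length fs = Suc N" and u: "\<forall>i\<le>Suc N. u i \<noteq> 0"
    and f: "\<And>n. n \<in> {1..Suc N} \<Longrightarrow>
      fs ! (n - 1) = (\<Sum>i\<le>n. monom (u i) i) \<and> irreducible (fs ! (n - 1))"
    using assms(1) unfolding consecutive_irreducible_seq_def by blast
  define gs where "gs = butlast fs"
  have nth: "gs ! (n - 1) = fs ! (n - 1)" if "n \<in> {1..N}" for n
    using that len by (intro nth_butlast[of _ fs, folded gs_def]) (auto simp: gs_def)
  have "length gs = N" by (simp add: gs_def len)
  moreover have "gs ! (n - 1) = (\<Sum>i\<le>n. monom (u i) i) \<and> irreducible (gs ! (n - 1))"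
    if "n \<in> {1..N}" for n
    unfolding nth[OF that] by (rule f) (use that in auto)
  moreover have "\<forall>i\<le>N. u i \<noteq> 0" using u by simp
  ultimately have "consecutive_irreducible_seq N gs"
    unfolding consecutive_irreducible_seq_def by blast
  moreover have "last gs = (\<Sum>i\<le>N. monom (u i) i)"
    using f[of N] nth[of N] assms(2) \<open>length gs = N\<close> by (subst last_conv_nth) auto
  then have last: "fs ! N = last gs + monom (u (Suc N)) (Suc N)"
    using f[of "Suc N"] by simp
  then have "fs = gs @ [last gs + monom (u (Suc N)) (Suc N)]"
    using len by (metis append_butlast_last_id diff_Suc_1 gs_def last_conv_nth length_0_conv nat.distinct(1))
  moreover have "poly (last gs) a + u (Suc N) * a ^ Suc N \<noteq> 0" for a
  proof -
    \<comment> \<open>The non-zero leading coefficient makes the degree at least 2, where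
      irreducibility excludes roots.\<close>
    have "coeff (fs ! N) (Suc N) \<noteq> 0"
      using f[of "Suc N"] u by (auto simp: coeff_sum_monom)
    then have "degree (fs ! N) \<ge> 2"
      using le_degree[of "fs ! N" "Suc N"] assms(2) by linarith
    then show ?thesis
      using irreducible_imp_no_root[of "fs ! N" a] f[of "Suc N"] last
      by (auto simp: poly_monom)
  qed
  ultimately show thesis using that u by blast
qed

section \<open>Recursive bounds on the number of sequences\<close>

definition irreducible_seqs :: "nat \<Rightarrow> 'a::field poly list set" where
  "irreducible_seqs N = {fs. consecutive_irreducible_seq N fs}"

text \<open>The single linear polynomial is determined by its two non-zero coefficients;
  irreducibility gives no saving here.\<close>

lemma irreducible_seqs_1:
  fixes R :: "'a::{field,finite} poly list set"
  defines "R \<equiv> irreducible_seqs 1"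
  shows "finite R" "card R \<le> (CARD('a) - 1) ^ 2"
proof -
  let ?S = "UNIV - {0 :: 'a}"
  let ?h = "\<lambda>(a, b). [monom a 0 + monom b 1] :: 'a poly list"
  have "R \<subseteq> ?h ` (?S \<times> ?S)"
  proof
    fix fs assume "fs \<in> R"
    then obtain u where u: "length fs = 1" "\<forall>i\<le>1. u i \<noteq> 0" "fs ! 0 = (\<Sum>i\<le>1. monom (u i) i)"
      by (auto simp: R_def irreducible_seqs_def consecutive_irreducible_seq_def)
    then have "fs = ?h (u 0, u 1)"
      by (cases fs) auto
    with u(2) show "fs \<in> ?h ` (?S \<times> ?S)" by (intro image_eqI[of _ _ "(u 0, u 1)"]) auto
  qed
  moreover from this show "finite R" by (rule finite_subset) simp
  ultimately have "card R \<le> card (?S \<times> ?S)"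
    by (meson card_image_le card_mono finite finite_imageI order_trans)
  then show "card R \<le> (CARD('a) - 1) ^ 2"
    by (simp add: card_Diff_singleton power2_eq_square)
qed

text \<open>A crude bound from \<open>u \<noteq> 0\<close> alone. It carries finiteness to all
  lengths and starts the chain of even lengths at 2.\<close>

lemma irreducible_seqs_Suc:
  fixes R :: "nat \<Rightarrow> 'a::{field,finite} poly list set"
  defines "R \<equiv> irreducible_seqs"
  assumes "N \<ge> 1" "finite (R N)"
  shows "finite (R (Suc N))" "card (R (Suc N)) \<le> (CARD('a) - 1) * card (R N)"
proof -
  let ?S = "UNIV - {0 :: 'a}"
  let ?h = "\<lambda>(gs, u). gs @ [last gs + monom u (Suc N)] :: 'a poly list"
  have sub: "R (Suc N) \<subseteq> ?h ` (R N \<times> ?S)"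
  proof
    fix fs assume "fs \<in> R (Suc N)"
    then have "consecutive_irreducible_seq (Suc N) fs" by (simp add: R_def irreducible_seqs_def)
    then obtain gs u where "consecutive_irreducible_seq N gs" "u \<noteq> 0" "fs = ?h (gs, u)"
      using assms(2) by (auto elim: consecutive_irreducible_seq_Suc)
    moreover from this have "gs \<in> R N" by (simp add: R_def irreducible_seqs_def)
    ultimately have "gs \<in> R N" "u \<noteq> 0" "fs = ?h (gs, u)" by auto
    then show "fs \<in> ?h ` (R N \<times> ?S)" by (intro image_eqI[of _ _ "(gs, u)"]) auto
  qed
  have fin: "finite (R N \<times> ?S)" using assms(3) by simp
  show "finite (R (Suc N))" using sub fin by (meson finite_imageI finite_subset)
  have "card (R (Suc N)) \<le> card (R N \<times> ?S)"
    using sub fin by (rule surj_card_le[rotated])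
  then show "card (R (Suc N)) \<le> (CARD('a) - 1) * card (R N)"
    by (simp add: card_cartesian_product card_Diff_singleton mult.commute)
qed

lemma finite_irreducible_seqs:
  assumes "N \<ge> 1"
  shows "finite (irreducible_seqs N :: 'a::{field,finite} poly list set)"
  using assms by (induction N rule: dec_induct) (use irreducible_seqs_1 irreducible_seqs_Suc in auto)

text \<open>Peeling twice encodes a sequence by its prefix \<open>gs\<close> and a pair of
  coefficients that is a root-free extension of \<open>last gs\<close>; at most half of (q-1)^2
  pairs qualify for each prefix.\<close>

lemma card_irreducible_seqs_Suc_Suc:
  fixes R :: "nat \<Rightarrow> 'a::{field,finite} poly list set"
  defines "R \<equiv> irreducible_seqs"
  assumes "N \<ge> 1"
  shows "2 * card (R (Suc (Suc N))) \<le> (CARD('a) - 1) ^ 2 * card (R N)"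
proof -
  let ?P = "\<lambda>gs. root_free_extensions (poly (last gs)) (Suc N) :: ('a \<times> 'a) set"
  let ?h = "\<lambda>(gs, u, v). gs @ [last gs + monom u (Suc N),
    last gs + monom u (Suc N) + monom v (Suc (Suc N))] :: 'a poly list"
  have fin: "finite (R N)" using assms by (simp add: finite_irreducible_seqs)
  have "R (Suc (Suc N)) \<subseteq> ?h ` (SIGMA gs:R N. ?P gs)"
  proof
    fix fs assume "fs \<in> R (Suc (Suc N))"
    then have fs: "consecutive_irreducible_seq (Suc (Suc N)) fs"
      by (simp add: R_def irreducible_seqs_def)
    obtain gs' v where 1: "consecutive_irreducible_seq (Suc N) gs'" "v \<noteq> 0"
      "fs = gs' @ [last gs' + monom v (Suc (Suc N))]"
      "\<And>a. poly (last gs') a + v * a ^ Suc (Suc N) \<noteq> 0"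
      using consecutive_irreducible_seq_Suc[OF fs] by auto
    obtain gs u where 2: "consecutive_irreducible_seq N gs"
      "gs' = gs @ [last gs + monom u (Suc N)]"
      "\<And>a. poly (last gs) a + u * a ^ Suc N \<noteq> 0"
      using consecutive_irreducible_seq_Suc[OF 1(1) assms(2)] by metis
    have "(u, v) \<in> ?P gs"
      using 1 2 by (auto simp: root_free_extensions_def poly_monom)
    moreover have "gs \<in> R N" using 2 by (simp add: R_def irreducible_seqs_def)
    moreover have "fs = ?h (gs, u, v)" using 1 2 by simp
    ultimately show "fs \<in> ?h ` (SIGMA gs:R N. ?P gs)" by (intro image_eqI) auto
  qed
  then have "card (R (Suc (Suc N))) \<le> card (SIGMA gs:R N. ?P gs)"
    using fin by (intro surj_card_le) auto
  also have "\<dots> = (\<Sum>gs\<in>R N. card (?P gs))"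
    using fin by simp
  finally have "2 * card (R (Suc (Suc N))) \<le> (\<Sum>gs\<in>R N. 2 * card (?P gs))"
    by (simp add: sum_distrib_left[symmetric])
  also have "\<dots> \<le> (\<Sum>gs\<in>R N. (CARD('a) - 1) ^ 2)"
    by (intro sum_mono card_root_free_extensions)
  finally show ?thesis by (simp add: mult.commute)
qed

text \<open>Induction in steps of two from lengths 1 and 2. Here \<open>n\<close> is the length
  minus one, and \<open>n + 2\<close> is the number of coefficients.\<close>

lemma card_irreducible_seqs_le:
  "2 ^ (n div 2) * card (irreducible_seqs (Suc n) :: 'a::{field,finite} poly list set)
     \<le> (CARD('a) - 1) ^ (n + 2)"
proof (induction n rule: less_induct)
  case (less n)
  let ?R = "\<lambda>n. card (irreducible_seqs n :: 'a poly list set)"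
  let ?M = "CARD('a) - 1"
  consider "n = 0" | "n = 1" | k where "n = Suc (Suc k)"
    by (metis One_nat_def not0_implies_Suc)
  then show ?case
  proof cases
    case 1
    then show ?thesis using irreducible_seqs_1(2)[where 'a = 'a] by (simp add: power2_eq_square)
  next
    case 2
    have "?R (Suc 1) \<le> ?M * ?R 1"
      by (intro irreducible_seqs_Suc finite_irreducible_seqs) auto
    also have "\<dots> \<le> ?M * ?M ^ 2"
      using irreducible_seqs_1(2)[where 'a = 'a] by (rule mult_left_mono) simp
    finally show ?thesis using 2 by (simp add: eval_nat_numeral)
  next
    case 3
    have "2 ^ (n div 2) * ?R (Suc n) = 2 ^ (k div 2) * (2 * ?R (Suc (Suc (Suc k))))"
      using 3 by simp
    also have "\<dots> \<le> 2 ^ (k div 2) * (?M ^ 2 * ?R (Suc k))"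
      by (intro mult_left_mono card_irreducible_seqs_Suc_Suc) auto
    also have "\<dots> = ?M ^ 2 * (2 ^ (k div 2) * ?R (Suc k))"
      by (simp only: ac_simps)
    also have "\<dots> \<le> ?M ^ 2 * ?M ^ (k + 2)"
      using 3 by (intro mult_left_mono less.IH) auto
    finally show ?thesis using 3 by (simp add: power2_eq_square mult.assoc)
  qed
qed

section \<open>Comparison with powers of three\<close>

lemma three_powr_le: "3 powr (real N / 7) \<le> 3 * 2 ^ ((N - 1) div 2)"
proof -
  have "3 powr (real N / 7) = (3 powr 2) powr (real N / 14)"
    unfolding powr_powr by simp
  also have "\<dots> = (3 ^ 2) powr (real N / 14)" by simp
  \<comment> \<open>The claim 3^(1/7) <= 2^(1/2), raised to the 14th power, is 9 <= 128.\<close>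
  also have "\<dots> \<le> (2 ^ 7) powr (real N / 14)"
    by (intro powr_mono2) auto
  also have "\<dots> = (2 powr 7) powr (real N / 14)" by simp
  also have "\<dots> = 2 powr (real N / 2)"
    unfolding powr_powr by simp
  \<comment> \<open>Rounding down in \<open>(N - 1) div 2\<close> costs at most a factor 2, attained
    for positive even \<open>N\<close>; the factor 3 in the bound absorbs it.\<close>
  also have "\<dots> \<le> 2 powr (1 + real ((N - 1) div 2))"
    by (intro powr_mono) linarith+
  also have "\<dots> = 2 * 2 ^ ((N - 1) div 2)"
    by (simp add: powr_add powr_realpow)
  also have "\<dots> \<le> 3 * 2 ^ ((N - 1) div 2)" by simp
  finally show ?thesis .
qed

theorem theorem5p1:
  fixes p s q N :: nat
  assumes "prime p" and "odd p" and "s \<ge> 1" and "q = p ^ s"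
    and "CARD('a::{field,finite}) = q"
    and "N \<ge> 2"
  shows "real (num_consecutive_irreducible_seqs TYPE('a) N)
           < 3 powr (- real N / 7 + 1) * real q ^ (N + 1)"
proof -
  let ?I = "num_consecutive_irreducible_seqs TYPE('a) N"
  have "q > 0" using assms(5) by (metis zero_less_card_finite)
  have "2 ^ ((N - 1) div 2) * ?I \<le> (q - 1) ^ (N + 1)"
    using card_irreducible_seqs_le[of "N - 1", where 'a = 'a] assms(5,6)
    by (simp add: num_consecutive_irreducible_seqs_def irreducible_seqs_def Suc_diff_Suc numeral_2_eq_2)
  \<comment> \<open>The strict inequality of the theorem comes from
    \<open>q - 1 < q\<close>.\<close>
  also have "\<dots> < q ^ (N + 1)"
    using \<open>q > 0\<close> by (intro power_strict_mono) auto
  finally have "real (2 ^ ((N - 1) div 2) * ?I) < real (q ^ (N + 1))"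
    by (simp only: of_nat_less_iff)
  then have *: "2 ^ ((N - 1) div 2) * real ?I < real q ^ (N + 1)" by simp
  have "3 powr (real N / 7) * real ?I \<le> 3 * 2 ^ ((N - 1) div 2) * real ?I"
    by (intro mult_right_mono three_powr_le) simp
  also have "\<dots> < 3 * real q ^ (N + 1)"
    using * by simp
  finally have "real ?I < 3 * real q ^ (N + 1) / 3 powr (real N / 7)"
    by (simp add: pos_less_divide_eq mult.commute)
  also have "\<dots> = 3 powr (- real N / 7 + 1) * real q ^ (N + 1)"
    by (simp add: powr_diff)
  finally show ?thesis .
qed

end
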